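(* Let $\lambda=\{\lambda_v\}_{v\in V}$ be a system of weights on a directed forest $\mathcal T=(V,p)$. Then $\mathcal T_\lambda=(V,p_\lambda)$, where $$p_\lambda(v):=\begin{cases}p(v)&\text{if }\lambda_v\ne0,\\ v&\text{if }\lambda_v=0,\end{cases}\qquad v\in V,$$ is a directed forest on which the weighted shift with weights $\lambda$ is proper and, as an operator acting in $\ell^2(V)$, equals the weighted shift on $\mathcal T$ with the same weights.
   Context: A directed forest is a pair $\mathcal T=(V,p)$ where $V$ is a nonempty set and $p:V\to V$ is a function such that $p^n(v)=v$ with $n\ge 1$ implies $p(v)=v$. $\mathrm{root}(\mathcal T)=\{v\in V:p(v)=v\}$. A system of weights on $\mathcal T$ is $\lambda=\{\lambda_v\}_{v\in V}\subseteq\mathbb C$ with $\lambda_v=0$ for every root $v$. The weighted shift $S_\lambda$ on $\mathcal T$ with weights $\lambda$ is the (possibly unbounded) operator in $\ell^2(V)$ defined as follows: let $\tilde S:\mathbb C^V\to\mathbb C^V$, $\tilde S(f)(v)=\lambda_v f(p(v))$; the domain is $\mathscr D(S_\lambda)=\{f\in\ell^2(V):\tilde S(f)\in\ell^2(V)\}$, and $S_\lambda f=\tilde S(f)$ for $f\in\mathscr D(S_\lambda)$. It is proper (on $\mathcal T$) if $\{v\in V:\lambda_v=0\}=\mathrm{root}(\mathcal T)$. *)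

theory Defs
  imports "HOL-Analysis.Analysis" "HOL-Library.FuncSet"
begin

definition directed_forest :: "'a set \<Rightarrow> ('a \<Rightarrow> 'a) \<Rightarrow> bool" where
  "directed_forest V p \<longleftrightarrow>
     V \<noteq> {} \<and> p \<in> V \<rightarrow> V \<and>
     (\<forall>v\<in>V. \<forall>n::nat. n \<ge> 1 \<and> (p ^^ n) v = v \<longrightarrow> p v = v)"

definition forest_roots :: "'a set \<Rightarrow> ('a \<Rightarrow> 'a) \<Rightarrow> 'a set" where
  "forest_roots V p = {v \<in> V. p v = v}"

text \<open>Weights are total functions on the ambient type; only their values on \<open>V\<close> matter.\<close>

definition system_of_weights ::
    "'a set \<Rightarrow> ('a \<Rightarrow> 'a) \<Rightarrow> ('a \<Rightarrow> complex) \<Rightarrow> bool" where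
  "system_of_weights V p lam \<longleftrightarrow> (\<forall>v\<in>forest_roots V p. lam v = 0)"

text \<open>The space of all complex functions on \<open>V\<close> is \<open>V \<rightarrow>\<^sub>E UNIV\<close>: functions are
  normalised to \<open>undefined\<close> outside \<open>V\<close>, so that equality means equality on \<open>V\<close>.\<close>

definition ell2 :: "'a set \<Rightarrow> ('a \<Rightarrow> complex) set" where
  "ell2 V = {f \<in> V \<rightarrow>\<^sub>E UNIV. (\<lambda>v. (cmod (f v))\<^sup>2) summable_on V}"

definition shift_map ::
    "'a set \<Rightarrow> ('a \<Rightarrow> 'a) \<Rightarrow> ('a \<Rightarrow> complex) \<Rightarrow> ('a \<Rightarrow> complex) \<Rightarrow> ('a \<Rightarrow> complex)" where
  "shift_map V p lam f = (\<lambda>v\<in>V. lam v * f (p v))"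

text \<open>A possibly unbounded operator is a partial map: its domain is \<open>dom\<close>, and two
  operators are equal iff their domains and their values on the domain coincide.\<close>

definition weighted_shift ::
    "'a set \<Rightarrow> ('a \<Rightarrow> 'a) \<Rightarrow> ('a \<Rightarrow> complex) \<Rightarrow> (('a \<Rightarrow> complex) \<rightharpoonup> ('a \<Rightarrow> complex))" where
  "weighted_shift V p lam =
     (\<lambda>f. if f \<in> ell2 V \<and> shift_map V p lam f \<in> ell2 V
          then Some (shift_map V p lam f) else None)"

text \<open>Properness depends on the forest and the weights, not on the operator alone.\<close>

definition proper_weighted_shift ::
    "'a set \<Rightarrow> ('a \<Rightarrow> 'a) \<Rightarrow> ('a \<Rightarrow> complex) \<Rightarrow> bool" where
  "proper_weighted_shift V p lam \<longleftrightarrow> {v \<in> V. lam v = 0} = forest_roots V p"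

definition pruned_parent :: "('a \<Rightarrow> 'a) \<Rightarrow> ('a \<Rightarrow> complex) \<Rightarrow> 'a \<Rightarrow> 'a" where
  "pruned_parent p lam v = (if lam v \<noteq> 0 then p v else v)"

end

theory Submission
  imports Defs
begin

text \<open>Passing to \<open>pruned_parent\<close> cuts the edge from each vertex of weight zero to
  its parent. Cutting edges creates no new cycle: an orbit follows \<open>p\<close> until it meets a
  vertex of weight zero and stays there (\<open>funpow_pruned_parent\<close>). The shift does not
  notice the cut, since the parent of \<open>v\<close> enters only through a product with
  \<open>lam v\<close> (\<open>shift_map_pruned_parent\<close>).\<close>

lemma funpow_pruned_parent:
  "lam ((pruned_parent p lam ^^ n) v) = 0 \<or> (pruned_parent p lam ^^ n) v = (p ^^ n) v"
  by (induction n) (auto simp: pruned_parent_def)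

lemma directed_forest_pruned_parent:
  assumes "directed_forest V p"
  shows "directed_forest V (pruned_parent p lam)"
  unfolding directed_forest_def
proof (intro conjI ballI allI impI)
  show "V \<noteq> {}" "pruned_parent p lam \<in> V \<rightarrow> V"
    using assms by (auto simp: directed_forest_def pruned_parent_def Pi_iff)
next
  fix v and n :: nat
  assume "v \<in> V" and cyc: "1 \<le> n \<and> (pruned_parent p lam ^^ n) v = v"
  \<comment> \<open>On a cycle the iterate is \<open>v\<close> itself, so either \<open>v\<close>
    has been cut loose or the cycle is one of \<open>p\<close>, which must be trivial.\<close>
  from funpow_pruned_parent[where lam = lam and p = p and n = n and v = v] cyc have "lam v = 0 \<or> (p ^^ n) v = v"
    by auto
  then have "lam v = 0 \<or> p v = v"
    using assms \<open>v \<in> V\<close> cyc by (auto simp: directed_forest_def)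
  then show "pruned_parent p lam v = v"
    by (auto simp: pruned_parent_def)
qed

text \<open>A vertex of nonzero weight is not a root for \<open>p\<close>, so it keeps a parent
  other than itself. This yields both properness and the weight condition for the new
  forest.\<close>

lemma forest_roots_pruned_parent:
  assumes "system_of_weights V p lam"
  shows "forest_roots V (pruned_parent p lam) = {v \<in> V. lam v = 0}"
  using assms by (auto simp: forest_roots_def system_of_weights_def pruned_parent_def)

text \<open>The parent changes only where the factor \<open>lam v\<close> is zero. Since this holds
  before restricting to \<open>ell2 V\<close>, the domains of the two operators agree as
  well.\<close>

lemma shift_map_pruned_parent: "shift_map V (pruned_parent p lam) lam = shift_map V p lam"
  by (auto simp: shift_map_def pruned_parent_def fun_eq_iff restrict_def)

theorem proposition3p2:
  fixes V :: "'a set" and p :: "'a \<Rightarrow> 'a" and lam :: "'a \<Rightarrow> complex"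
  assumes "directed_forest V p"
    and "system_of_weights V p lam"
  shows "directed_forest V (pruned_parent p lam)
    \<and> system_of_weights V (pruned_parent p lam) lam
    \<and> proper_weighted_shift V (pruned_parent p lam) lam
    \<and> weighted_shift V (pruned_parent p lam) lam = weighted_shift V p lam"
  using directed_forest_pruned_parent[OF assms(1)] forest_roots_pruned_parent[OF assms(2)]
  unfolding system_of_weights_def proper_weighted_shift_def weighted_shift_def
    shift_map_pruned_parent
  by simp

end
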